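(* Let $n\ge 3$, let $a_0,\ldots,a_{n-1}$ be indeterminates over $\mathbb{Q}$, $f=x^n+a_{n-1}x^{n-1}+\cdots+a_0$, and \[f_1(x,y)=\frac{f(y)-f(x)}{y-x},\qquad f_3(x,y)=\frac{f(y)-2f\left(\frac{x+y}{2}\right)+f(x)}{\frac{(y-x)^2}{2}},\] $g_1(x,y)=f_1(x-y,x+y)$, $g_3(x,y)=f_3(x-y,x+y)$. Let $D_2\in\mathbb{Q}[a_0,\ldots,a_{n-1}]$ be the polynomial obtained by expressing $\prod_{1\le i,j,k\le n,\ i<j,\ j\ne k,\ k\ne i}(2r_k-r_i-r_j)$ ($r_1,\ldots,r_n$ the roots of $f$) in terms of $a_0,\ldots,a_{n-1}$ via Vieta's formulas. Then, in $\mathbb{Q}[a_0,\ldots,a_{n-1},x,y]$, \[D_2\in\langle f(x),g_1(x,y),g_3(x,y)\rangle\cap\mathbb{Q}[a_0,\ldots,a_{n-1}].\]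
   Context: $\langle g_1,\ldots,g_m\rangle$ is the ideal generated by $g_1,\ldots,g_m$. *)

theory Defs
  imports "HOL-Library.Poly_Mapping" "HOL-Computational_Algebra.Polynomial"
begin

(* Multivariate polynomials over the rationals in countably many indeterminates
  indexed by natural numbers: a polynomial maps monomials (exponent vectors
  of type nat =>0 nat) to rational coefficients.  This is the representation
  of multivariate polynomials used by the AFP (MPoly). *)

type_synonym mpoly = "(nat \<Rightarrow>\<^sub>0 nat) \<Rightarrow>\<^sub>0 rat"

definition mVar :: "nat \<Rightarrow> mpoly" where
  "mVar i = Poly_Mapping.single (Poly_Mapping.single i 1) 1"

definition mConst :: "rat \<Rightarrow> mpoly" where
  "mConst c = Poly_Mapping.single 0 c"

definition mvars :: "mpoly \<Rightarrow> nat set" where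
  "mvars p = (\<Union>m\<in>Poly_Mapping.keys p. Poly_Mapping.keys m)"

definition msubst :: "(nat \<Rightarrow> mpoly) \<Rightarrow> mpoly \<Rightarrow> mpoly" where
  "msubst \<sigma> p = (\<Sum>m\<in>Poly_Mapping.keys p. mConst (Poly_Mapping.lookup p m) * (\<Prod>i\<in>Poly_Mapping.keys m. \<sigma> i ^ Poly_Mapping.lookup m i))"

(* Variable layout for given n: a_i = mVar i (i < n), x = mVar n, y = mVar (n+1);
  the roots r_k (k < n) used for Vieta are the auxiliary indeterminates mVar (n+2+k). *)

definition xV :: "nat \<Rightarrow> mpoly" where "xV n = mVar n"
definition yV :: "nat \<Rightarrow> mpoly" where "yV n = mVar (Suc n)"
definition rV :: "nat \<Rightarrow> nat \<Rightarrow> mpoly" where "rV n k = mVar (n + 2 + k)"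

definition fpoly :: "nat \<Rightarrow> mpoly \<Rightarrow> mpoly" where
  "fpoly n t = t ^ n + (\<Sum>i<n. mVar i * t ^ i)"

definition f1 :: "nat \<Rightarrow> mpoly" where
  "f1 n = (THE h. (yV n - xV n) * h = fpoly n (yV n) - fpoly n (xV n))"

definition f3 :: "nat \<Rightarrow> mpoly" where
  "f3 n = (THE h. (mConst (1/2) * (yV n - xV n)^2) * h =
      fpoly n (yV n) - mConst 2 * fpoly n (mConst (1/2) * (xV n + yV n)) + fpoly n (xV n))"

definition xy_sub :: "nat \<Rightarrow> nat \<Rightarrow> mpoly" where
  "xy_sub n i = (if i = n then xV n - yV n else if i = Suc n then xV n + yV n else mVar i)"

definition g1 :: "nat \<Rightarrow> mpoly" where "g1 n = msubst (xy_sub n) (f1 n)"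
definition g3 :: "nat \<Rightarrow> mpoly" where "g3 n = msubst (xy_sub n) (f3 n)"

definition vieta_sub :: "nat \<Rightarrow> nat \<Rightarrow> mpoly" where
  "vieta_sub n i = (if i < n then coeff (\<Prod>k<n. [:- rV n k, 1:]) i else mVar i)"

definition root_prod :: "nat \<Rightarrow> mpoly" where
  "root_prod n = (\<Prod>(i,j,k)\<in>{(i,j,k). i < n \<and> j < n \<and> k < n \<and> i < j \<and> j \<noteq> k \<and> k \<noteq> i}.
      mConst 2 * rV n k - rV n i - rV n j)"

definition is_D2 :: "nat \<Rightarrow> mpoly \<Rightarrow> bool" where
  "is_D2 n P \<longleftrightarrow> mvars P \<subseteq> {..<n} \<and> msubst (vieta_sub n) P = root_prod n"

end

theory Submission
  imports Defs
begin

text \<open>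
  Let \<open>r\<^sub>0, \<dots>, r\<^bsub>n-1\<^esub>\<close> be the roots of \<open>f\<close>, and \<open>K\<close> the ideal generated by \<open>f(x), g\<^sub>1, g\<^sub>3\<close> after adjoining
  them. Modulo \<open>x - r\<^sub>k\<close>, the polynomials \<open>g\<^sub>1\<close> and \<open>g\<^sub>3\<close> are the even and odd parts \<open>E(y\<^sup>2)\<close>, \<open>D(y\<^sup>2)\<close> of
  \<open>\<Prod>\<^bsub>i\<noteq>k\<^esub>(y + x - r\<^sub>i) = E(y\<^sup>2) + y D(y\<^sup>2)\<close>, and the ideal generated by the even and odd parts of
  \<open>\<Prod>(y + s\<^sub>i)\<close> contains \<open>\<Prod>\<^bsub>i<j\<^esub>(s\<^sub>i + s\<^sub>j)\<close> (Orlando's formula for the Hurwitz determinant). Hence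
  \<open>Q\<^sub>k = \<Prod>\<^bsub>i<j\<^esub>(2r\<^sub>k - r\<^sub>i - r\<^sub>j)\<close> lies in \<open>K + (x - r\<^sub>k)\<close> for each \<open>k\<close>, and multiplying over \<open>k\<close> gives
  \<open>D\<^sub>2 = \<Prod>Q\<^sub>k \<in> K + (f(x)) = K\<close>.

  The roots are adjoined as new variables subject to the Cauchy modules: \<open>q\<^sub>0 = f\<close>, \<open>q\<^bsub>k+1\<^esub>\<close> is the
  quotient of \<open>q\<^sub>k\<close> by \<open>t - r\<^sub>k\<close>, and the \<open>k\<close>-th relation is \<open>q\<^sub>k(r\<^sub>k) = 0\<close>. Each relation is monic in the
  newest variable, so division with remainder eliminates the variables one by one without enlarging
  the ideal of the base ring.
\<close>

subsection \<open>Ideals\<close>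

abbreviation ideal :: "'a::comm_ring_1 set \<Rightarrow> 'a set" where
  "ideal \<equiv> module.span (*)"

lemma module_times: "module ((*) :: 'a::comm_ring_1 \<Rightarrow> 'a \<Rightarrow> 'a)"
  by unfold_locales (simp_all add: algebra_simps)

lemmas ideal_base = module.span_base[OF module_times]
  and ideal_zero = module.span_zero[OF module_times]
  and ideal_add = module.span_add[OF module_times]
  and ideal_diff = module.span_diff[OF module_times]
  and ideal_mult_left = module.span_scale[OF module_times]
  and ideal_sum = module.span_sum[OF module_times]
  and ideal_insert_iff = module.span_breakdown_eq[OF module_times]
  and ideal_induct = module.span_induct_alt[OF module_times, consumes 1, case_names zero add]

lemma ideal_mult_right: "a \<in> ideal G \<Longrightarrow> a * c \<in> ideal G"
  using ideal_mult_left[of a G c] by (simp add: mult.commute)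

lemma ideal_insertI: "a = k * u + g \<Longrightarrow> g \<in> ideal G \<Longrightarrow> a \<in> ideal (insert u G)"
  unfolding ideal_insert_iff by (rule exI[of _ k]) simp

text \<open>Modulo \<open>G\<close> the factors are multiples of \<open>u\<close> and of
  \<open>v\<close>, and such congruences multiply. Iterated, this combines memberships modulo the
  single factors \<open>x - r k\<close> into one modulo their product.\<close>

lemma ideal_insert_mult:
  assumes "a \<in> ideal (insert u G)" "b \<in> ideal (insert v G)"
  shows "a * b \<in> ideal (insert (u * v) G)"
proof -
  obtain k l where k: "a - k * u \<in> ideal G" and l: "b - l * v \<in> ideal G"
    using assms unfolding ideal_insert_iff by blast
  have "a * b = (k * l) * (u * v) + ((a - k * u) * b + (k * u) * (b - l * v))"
    by (simp add: algebra_simps)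
  then show ?thesis
    by (rule ideal_insertI) (intro ideal_add ideal_mult_right[OF k] ideal_mult_left[OF l])
qed

lemma ideal_insert_prod:
  assumes "finite A" "\<And>i. i \<in> A \<Longrightarrow> a i \<in> ideal (insert (u i) G)"
  shows "prod a A \<in> ideal (insert (prod u A) G)"
  using assms
proof (induction A rule: finite_induct)
  case empty
  show ?case by (simp add: ideal_base)
next
  case (insert i A)
  then show ?case by (simp add: ideal_insert_mult)
qed

lemma ideal_prod_cong:
  assumes "finite A" "\<And>i. i \<in> A \<Longrightarrow> a i - b i \<in> ideal G"
  shows "prod a A - prod b A \<in> ideal G"
  using assms
proof (induction A rule: finite_induct)
  case empty
  show ?case by (simp add: ideal_zero)
next
  case (insert i A)
  have "prod a (insert i A) - prod b (insert i A) =
      (a i - b i) * prod a A + b i * (prod a A - prod b A)"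
    using insert by (simp add: algebra_simps)
  then show ?case
    using insert by (simp add: ideal_add ideal_mult_left ideal_mult_right)
qed

lemma ideal_power_cong:
  assumes "a - b \<in> ideal G"
  shows "a ^ m - b ^ m \<in> ideal G"
  using ideal_prod_cong[of "{..<m}" "\<lambda>_. a" "\<lambda>_. b" G] assms by simp

text \<open>For an ideal \<open>K\<close> this is membership in the extension of \<open>K\<close> to
  the polynomial ring.\<close>

definition coeffs_in :: "'a::comm_ring_1 set \<Rightarrow> 'a poly \<Rightarrow> bool" where
  "coeffs_in K p \<longleftrightarrow> (\<forall>i. coeff p i \<in> K)"

lemma coeffs_in_add: "coeffs_in (ideal G) p \<Longrightarrow> coeffs_in (ideal G) q \<Longrightarrow> coeffs_in (ideal G) (p + q)"
  by (simp add: coeffs_in_def ideal_add)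

lemma coeffs_in_diff: "coeffs_in (ideal G) p \<Longrightarrow> coeffs_in (ideal G) q \<Longrightarrow> coeffs_in (ideal G) (p - q)"
  by (simp add: coeffs_in_def ideal_diff)

lemma coeffs_in_mult_left: "coeffs_in (ideal G) p \<Longrightarrow> coeffs_in (ideal G) (q * p)"
  by (simp add: coeffs_in_def coeff_mult ideal_sum ideal_mult_left)

lemma coeffs_in_const: "a \<in> ideal G \<Longrightarrow> coeffs_in (ideal G) [:a:]"
  by (simp add: coeffs_in_def ideal_zero coeff_pCons split: nat.split)

text \<open>Long division by a monic \<open>c\<close> never divides coefficients: each step
  subtracts a multiple of \<open>c\<close> by a monomial whose coefficient is already in the
  ideal.\<close>

lemma coeffs_in_monic_division:
  fixes c :: "'a::comm_ring_1 poly"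
  assumes "lead_coeff c = 1" "degree c > 0" "coeffs_in (ideal G) p"
  shows "\<exists>q r. p = c * q + r \<and> degree r < degree c \<and> coeffs_in (ideal G) r"
  using assms(3)
proof (induction "degree p" arbitrary: p rule: less_induct)
  case less
  show ?case
  proof (cases "degree p < degree c")
    case True
    then show ?thesis
      using less.prems by (intro exI[of _ 0] exI[of _ p]) simp
  next
    case False
    define t where "t = monom (lead_coeff p) (degree p - degree c)"
    define p' where "p' = p - c * t"
    have t: "coeffs_in (ideal G) t"
      using less.prems by (simp add: coeffs_in_def t_def ideal_zero)
    have p': "coeffs_in (ideal G) p'"
      unfolding p'_def by (intro coeffs_in_diff less.prems coeffs_in_mult_left t)
    have "degree (c * t) \<le> degree p"
      using degree_mult_le[of c t] degree_monom_le[of "lead_coeff p" "degree p - degree c"] False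
      unfolding t_def by linarith
    moreover have "coeff (c * t) (degree p) = lead_coeff p"
      using assms(1) False by (simp add: t_def mult.commute[of c] coeff_monom_mult)
    \<comment> \<open>If \<open>p'\<close> vanishes, its degree is 0, which is still smaller because
      \<open>degree p\<close> is at least \<open>degree c > 0\<close>.\<close>
    ultimately have "degree p' < degree p"
      using assms(2) False unfolding p'_def
      by (cases "p = c * t") (auto intro!: degree_less_if_less_eqI degree_diff_le)
    from less.hyps[OF this p'] obtain q r
      where "p' = c * q + r" "degree r < degree c" "coeffs_in (ideal G) r" by blast
    then show ?thesis
      by (intro exI[of _ "q + t"] exI[of _ r]) (simp add: p'_def algebra_simps)
  qed
qed

subsection \<open>Even and odd parts of a product of linear factors\<close>

text \<open>The recursion is multiplication of \<open>E + y D\<close> by \<open>y + s\<close>, with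
  \<open>z\<close> in place of \<open>y^2\<close>. Keeping \<open>z\<close> as a separate argument
  permits the specialisation \<open>z = s^2\<close>.\<close>

fun even_part odd_part :: "'a::comm_ring_1 \<Rightarrow> 'a list \<Rightarrow> 'a" where
  "even_part z [] = 1"
| "odd_part z [] = 0"
| "even_part z (s # ss) = z * odd_part z ss + s * even_part z ss"
| "odd_part z (s # ss) = even_part z ss + s * odd_part z ss"

fun pair_sum_prod :: "'a::comm_ring_1 list \<Rightarrow> 'a" where
  "pair_sum_prod [] = 1"
| "pair_sum_prod (s # ss) = (\<Prod>t\<leftarrow>ss. s + t) * pair_sum_prod ss"

lemma even_odd_part_square:
  "even_part (y\<^sup>2) ss + y * odd_part (y\<^sup>2) ss = (\<Prod>s\<leftarrow>ss. y + s)"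
proof (induction ss)
  case (Cons s ss)
  show ?case
    unfolding list.map prod_list.Cons Cons[symmetric]
    by (simp add: algebra_simps power2_eq_square)
qed simp

text \<open>Both parts are polynomial in their first argument. With \<open>w = s^2\<close> this
  allows reduction modulo \<open>z - s^2\<close>.\<close>

lemma diff_dvd_even_odd_part_diff:
  "z - w dvd even_part z ss - even_part w ss \<and> z - w dvd odd_part z ss - odd_part w ss"
proof (induction ss)
  case (Cons s ss)
  have "even_part z (s # ss) - even_part w (s # ss) =
      (z - w) * odd_part z ss + w * (odd_part z ss - odd_part w ss)
      + s * (even_part z ss - even_part w ss)"
    by (simp add: algebra_simps)
  moreover have "odd_part z (s # ss) - odd_part w (s # ss) =
      even_part z ss - even_part w ss + s * (odd_part z ss - odd_part w ss)"
    by (simp add: algebra_simps)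
  ultimately show ?case
    using Cons.IH by (metis dvd_add dvd_mult dvd_triv_left)
qed simp

lemma pair_sum_prod_in_ideal:
  "\<exists>a b. pair_sum_prod ss = a * even_part z ss + b * odd_part z ss"
proof (induction ss)
  case Nil
  show ?case by (intro exI[of _ 1] exI[of _ 0]) simp
next
  case (Cons s ss)
  then obtain a b where ab: "pair_sum_prod ss = a * even_part z ss + b * odd_part z ss"
    by blast
  \<comment> \<open>Writing \<open>E, D\<close> for the parts of \<open>s # ss\<close> and \<open>E\<^sub>0, D\<^sub>0\<close> for those of \<open>ss\<close>, we have
    \<open>(z - s\<^sup>2) E\<^sub>0 = z D - s E\<close> and \<open>(z - s\<^sup>2) D\<^sub>0 = E - s D\<close>, while \<open>D = E\<^sub>0 + s D\<^sub>0\<close> is congruent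
    to \<open>\<Prod>t\<leftarrow>ss. s + t\<close> modulo \<open>z - s\<^sup>2\<close>.\<close>
  have "z - s\<^sup>2 dvd (even_part z ss - even_part (s\<^sup>2) ss) + s * (odd_part z ss - odd_part (s\<^sup>2) ss)"
    by (intro dvd_add dvd_mult) (simp_all add: diff_dvd_even_odd_part_diff)
  also have "\<dots> = odd_part z (s # ss) - (\<Prod>t\<leftarrow>ss. s + t)"
    unfolding even_odd_part_square[of s, symmetric] by (simp add: algebra_simps)
  finally obtain w where "odd_part z (s # ss) - (\<Prod>t\<leftarrow>ss. s + t) = (z - s\<^sup>2) * w" ..
  then have w: "(\<Prod>t\<leftarrow>ss. s + t) = odd_part z (s # ss) - (z - s\<^sup>2) * w"
    by (simp add: algebra_simps)
  \<comment> \<open>Multiply \<open>w\<close> by \<open>pair_sum_prod ss = a E0 + b D0\<close>,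
    rewrite \<open>(z - s^2) E0\<close> and \<open>(z - s^2) D0\<close> by the identities above, and
    collect the coefficients of \<open>E\<close> and \<open>D\<close>.\<close>
  show ?case
    by (rule exI[of _ "w * (a * s - b)"],
        rule exI[of _ "pair_sum_prod ss - w * (a * z - b * s)"],
        unfold pair_sum_prod.simps w, unfold ab)
       (simp add: algebra_simps power2_eq_square)
qed

section \<open>Linear functionals on univariate polynomials, given by their values on the powers of
  the variable\<close>

definition lin_eval :: "(nat \<Rightarrow> 'a) \<Rightarrow> 'a::comm_ring_1 poly \<Rightarrow> 'a" where
  "lin_eval c p = (\<Sum>i\<le>degree p. coeff p i * c i)"

lemma lin_eval_extend:
  assumes "degree p \<le> N"
  shows "lin_eval c p = (\<Sum>i\<le>N. coeff p i * c i)"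
  unfolding lin_eval_def using assms
  by (intro sum.mono_neutral_left) (auto simp: coeff_eq_0)

lemma lin_eval_diff: "lin_eval c (p - q) = lin_eval c p - lin_eval c q"
proof -
  define N where "N = max (degree p) (degree q)"
  have "degree p \<le> N" "degree q \<le> N" "degree (p - q) \<le> N"
    by (auto simp: N_def intro: degree_diff_le_max)
  then show ?thesis
    by (simp add: lin_eval_extend algebra_simps sum_subtractf)
qed

lemma lin_eval_smult: "lin_eval c (smult a p) = a * lin_eval c p"
  unfolding lin_eval_extend[OF degree_smult_le] by (simp add: lin_eval_def sum_distrib_left mult.assoc)

lemma lin_eval_pCons: "lin_eval c (pCons a p) = a * c 0 + lin_eval (\<lambda>i. c (Suc i)) p"
  by (simp add: lin_eval_extend[OF degree_pCons_le] lin_eval_def sum.atMost_Suc_shift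
      del: sum.atMost_Suc)

text \<open>Multiplication by the variable shifts the sequence \<open>c\<close>; this drives the
  recursion over the roots.\<close>

lemma lin_eval_linear_factor:
  "lin_eval c ([:- r, 1:] * p) = lin_eval (\<lambda>i. c (Suc i)) p - r * lin_eval c p"
proof -
  have "[:- r, 1:] * p = pCons 0 p - smult r p" by simp
  then show ?thesis by (simp only: lin_eval_diff lin_eval_smult lin_eval_pCons) simp
qed

lemma lin_eval_add_fun: "lin_eval (\<lambda>i. c i + d i) p = lin_eval c p + lin_eval d p"
  by (simp add: lin_eval_def algebra_simps sum.distrib)

lemma lin_eval_mult_fun: "lin_eval (\<lambda>i. a * c i) p = a * lin_eval c p"
  by (simp add: lin_eval_def sum_distrib_left mult.left_commute)

lemma lin_eval_power: "lin_eval (\<lambda>i. x ^ i) p = poly p x"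
  by (simp add: lin_eval_def poly_altdef)

lemma lin_eval_in_ideal: "coeffs_in (ideal G) p \<Longrightarrow> lin_eval c p \<in> ideal G"
  unfolding lin_eval_def coeffs_in_def by (intro ideal_sum ideal_mult_right) simp

text \<open>\<open>g\<^sub>1\<close> and \<open>g\<^sub>3\<close> arise from \<open>f\<close> by replacing the powers of the variable by \<open>pow_odd x y\<close> and \<open>pow_even x y\<close>.\<close>

fun pow_odd pow_even :: "'a::comm_ring_1 \<Rightarrow> 'a \<Rightarrow> nat \<Rightarrow> 'a" where
  "pow_odd x y 0 = 0"
| "pow_even x y 0 = 0"
| "pow_odd x y (Suc i) = x ^ i + y\<^sup>2 * pow_even x y i + x * pow_odd x y i"
| "pow_even x y (Suc i) = pow_odd x y i + x * pow_even x y i"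

text \<open>The recursions of \<open>pow_odd\<close> and \<open>pow_even\<close> come from
  multiplying this splitting by \<open>x + y\<close> and separating odd from even powers of
  \<open>y\<close>.\<close>

lemma power_add_pow_odd_even: "(x + y) ^ i = x ^ i + y * pow_odd x y i + y\<^sup>2 * pow_even x y i"
  by (induction i) (simp_all add: algebra_simps power2_eq_square)

lemma power_diff_pow_odd_even: "(x - y) ^ i = x ^ i - y * pow_odd x y i + y\<^sup>2 * pow_even x y i"
proof (induction i)
  case (Suc i)
  show ?case
    unfolding power_Suc Suc by (simp add: algebra_simps power2_eq_square)
qed simp

text \<open>At \<open>x + y\<close> the factor becomes \<open>y + (x - r)\<close>, so this and the
  next lemma mirror the recursion of \<open>even_part\<close> and \<open>odd_part\<close> with
  \<open>s = x - r\<close>.\<close>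

lemma lin_eval_pow_odd_linear_factor:
  "lin_eval (pow_odd x y) ([:- r, 1:] * p) =
     poly p x + y\<^sup>2 * lin_eval (pow_even x y) p + (x - r) * lin_eval (pow_odd x y) p"
  by (simp only: lin_eval_linear_factor pow_odd.simps lin_eval_add_fun lin_eval_mult_fun lin_eval_power)
     (simp add: algebra_simps)

lemma lin_eval_pow_even_linear_factor:
  "lin_eval (pow_even x y) ([:- r, 1:] * p) =
     lin_eval (pow_odd x y) p + (x - r) * lin_eval (pow_even x y) p"
  by (simp only: lin_eval_linear_factor pow_even.simps lin_eval_add_fun lin_eval_mult_fun)
     (simp add: algebra_simps)

text \<open>Both sides are the parts, with respect to \<open>y\<close>, of \<open>p\<close> at
  \<open>x + y\<close>, that is, of the product of the \<open>y + (x - r)\<close>.\<close>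

lemma lin_eval_prod_linear_factors:
  fixes x y :: "'a::comm_ring_1" and rs :: "'a list"
  defines "p \<equiv> (\<Prod>r\<leftarrow>rs. [:- r, 1:])" and "ss \<equiv> map (\<lambda>r. x - r) rs"
  shows "poly p x + y\<^sup>2 * lin_eval (pow_even x y) p = even_part (y\<^sup>2) ss"
    and "lin_eval (pow_odd x y) p = odd_part (y\<^sup>2) ss"
proof -
  have "poly p x + y\<^sup>2 * lin_eval (pow_even x y) p = even_part (y\<^sup>2) ss \<and>
      lin_eval (pow_odd x y) p = odd_part (y\<^sup>2) ss"
    unfolding p_def ss_def
  proof (induction rs)
    case Nil
    show ?case by (simp add: lin_eval_def)
  next
    case (Cons r rs)
    then show ?case
      unfolding list.map prod_list.Cons lin_eval_pow_odd_linear_factor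
        lin_eval_pow_even_linear_factor poly_mult even_part.simps odd_part.simps
      by (auto simp add: algebra_simps dest!: sym[of _ "even_part _ _"] sym[of _ "odd_part _ _"])
  qed
  then show "poly p x + y\<^sup>2 * lin_eval (pow_even x y) p = even_part (y\<^sup>2) ss"
    and "lin_eval (pow_odd x y) p = odd_part (y\<^sup>2) ss" by simp_all
qed

section \<open>From even and odd parts to products over the roots\<close>

lemma pair_sum_prod_map:
  assumes "sorted_wrt (<) (ks :: nat list)"
  shows "pair_sum_prod (map s ks) = (\<Prod>(i, j)\<in>{(i, j). i \<in> set ks \<and> j \<in> set ks \<and> i < j}. s i + s j)"
  using assms
proof (induction ks)
  case Nil
  show ?case by simp
next
  case (Cons k ks)
  define A where "A = {(i, j). i \<in> set ks \<and> j \<in> set ks \<and> i < j}"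
  have fin: "finite A"
    by (rule finite_subset[of _ "set ks \<times> set ks"]) (auto simp: A_def)
  have split: "{(i, j). i \<in> set (k # ks) \<and> j \<in> set (k # ks) \<and> i < j} = Pair k ` set ks \<union> A"
    using Cons.prems by (auto simp: A_def dest: less_asym)
  have dist: "distinct ks"
    using Cons.prems strict_sorted_iff by auto
  have "(\<Prod>(i, j)\<in>Pair k ` set ks \<union> A. s i + s j) =
      (\<Prod>(i, j)\<in>Pair k ` set ks. s i + s j) * (\<Prod>(i, j)\<in>A. s i + s j)"
    using Cons.prems fin by (intro prod.union_disjoint) (auto simp: A_def)
  also have "(\<Prod>(i, j)\<in>Pair k ` set ks. s i + s j) = (\<Prod>j\<in>set ks. s k + s j)"
    by (subst prod.reindex) (auto simp: inj_on_def)
  also have "\<dots> = (\<Prod>t\<leftarrow>map s ks. s k + t)"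
    using dist by (simp add: prod.distinct_set_conv_list o_def)
  finally show ?case
    unfolding split using Cons by (simp add: A_def)
qed

lemma prod_pairs_in_ideal:
  fixes x y :: "'a::comm_ring_1" and r :: "nat \<Rightarrow> 'a" and n :: nat
  defines "F \<equiv> (\<Prod>k<n. [:- r k, 1:])"
  assumes k: "k < n"
    and odd: "lin_eval (pow_odd x y) F \<in> ideal G"
    and even: "lin_eval (pow_even x y) F \<in> ideal G"
  shows "(\<Prod>(i, j)\<in>{(i, j). i < n \<and> j < n \<and> i < j \<and> i \<noteq> k \<and> j \<noteq> k}. 2 * r k - r i - r j)
    \<in> ideal (insert (x - r k) G)" (is "?Q \<in> ?I")
proof -
  define ks where "ks = filter (\<lambda>i. i \<noteq> k) [0..<n]"
  define H where "H = (\<Prod>r\<leftarrow>map r ks. [:- r, 1:])"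
  define E where "E = even_part (y\<^sup>2) (map (\<lambda>i. x - r i) ks)"
  define D where "D = odd_part (y\<^sup>2) (map (\<lambda>i. x - r i) ks)"
  have set_ks: "set ks = {..<n} - {k}"
    by (auto simp: ks_def)
  have "F = [:- r k, 1:] * (\<Prod>i\<in>set ks. [:- r i, 1:])"
    unfolding F_def set_ks using k by (subst prod.remove[of _ k]) auto
  also have "(\<Prod>i\<in>set ks. [:- r i, 1:]) = H"
    using prod.distinct_set_conv_list[of ks "\<lambda>i. [:- r i, 1:]"] by (simp add: H_def o_def ks_def)
  finally have F: "F = [:- r k, 1:] * H" .
  \<comment> \<open>Modulo \<open>x - r k\<close> the extra factor \<open>y + (x - r k)\<close> is
    just \<open>y\<close>, which swaps parities: the odd functional of \<open>F\<close> yields the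
    even part of \<open>H\<close>, and the even functional yields the odd part.\<close>
  have "lin_eval (pow_odd x y) F = E + (x - r k) * D"
    using lin_eval_prod_linear_factors[where rs = "map r ks" and x = x and y = y]
    unfolding F lin_eval_pow_odd_linear_factor H_def E_def D_def by (simp add: o_def)
  then have "E = (- D) * (x - r k) + lin_eval (pow_odd x y) F"
    by (simp add: algebra_simps)
  then have E: "E \<in> ?I"
    by (rule ideal_insertI) (rule odd)
  have "lin_eval (pow_even x y) F = D + (x - r k) * lin_eval (pow_even x y) H"
    using lin_eval_prod_linear_factors[where rs = "map r ks" and x = x and y = y]
    unfolding F lin_eval_pow_even_linear_factor H_def E_def D_def by (simp add: o_def)
  then have "D = (- lin_eval (pow_even x y) H) * (x - r k) + lin_eval (pow_even x y) F"
    by (simp add: algebra_simps)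
  then have D: "D \<in> ?I"
    by (rule ideal_insertI) (rule even)
  obtain a b where "pair_sum_prod (map (\<lambda>i. x - r i) ks) = a * E + b * D"
    unfolding E_def D_def using pair_sum_prod_in_ideal by blast
  then have "pair_sum_prod (map (\<lambda>i. x - r i) ks) \<in> ?I"
    by (simp add: ideal_add ideal_mult_left E D)
  moreover have "{(i, j). i \<in> set ks \<and> j \<in> set ks \<and> i < j} =
      {(i, j). i < n \<and> j < n \<and> i < j \<and> i \<noteq> k \<and> j \<noteq> k}" (is "_ = ?P")
    by (auto simp: set_ks)
  moreover have "sorted_wrt (<) ks"
    unfolding ks_def by (intro sorted_wrt_filter) simp
  ultimately have P: "(\<Prod>(i, j)\<in>?P. (x - r i) + (x - r j)) \<in> ?I"
    using pair_sum_prod_map[of ks "\<lambda>i. x - r i"] by simp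
  have "finite ?P"
    by (rule finite_subset[of _ "{..<n} \<times> {..<n}"]) auto
  \<comment> \<open>The difference is \<open>-2 * (x - r k)\<close>, whatever \<open>i\<close> and
    \<open>j\<close> are.\<close>
  moreover have "(2 * r k - r i - r j) - ((x - r i) + (x - r j)) \<in> ?I" for i j
    by (rule ideal_insertI[of _ "-2" _ 0]) (simp_all add: ideal_zero algebra_simps)
  ultimately have "?Q - (\<Prod>(i, j)\<in>?P. (x - r i) + (x - r j)) \<in> ?I"
    by (intro ideal_prod_cong) auto
  from ideal_add[OF this P] show ?thesis by simp
qed

text \<open>\<open>F\<close> is assumed to split only modulo \<open>G\<close>, which is what the
  relations on the adjoined roots provide. Linear functionals transfer the memberships from
  \<open>F\<close> to the split product.\<close>

lemma root_product_in_ideal: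
  fixes x y :: "'a::comm_ring_1" and r :: "nat \<Rightarrow> 'a" and n :: nat
  assumes split: "coeffs_in (ideal G) (F - (\<Prod>k<n. [:- r k, 1:]))"
    and "poly F x \<in> ideal G"
    and "lin_eval (pow_odd x y) F \<in> ideal G"
    and "lin_eval (pow_even x y) F \<in> ideal G"
  shows "(\<Prod>(i,j,k)\<in>{(i,j,k). i < n \<and> j < n \<and> k < n \<and> i < j \<and> j \<noteq> k \<and> k \<noteq> i}.
      2 * r k - r i - r j) \<in> ideal G"
proof -
  define P where "P = (\<Prod>k<n. [:- r k, 1:])"
  have cong: "lin_eval c P \<in> ideal G" if "lin_eval c F \<in> ideal G" for c
    using ideal_diff[OF that lin_eval_in_ideal[OF split[folded P_def], of c]]
    by (simp add: lin_eval_diff)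
  define Q where "Q k = (\<Prod>(i, j)\<in>{(i, j). i < n \<and> j < n \<and> i < j \<and> i \<noteq> k \<and> j \<noteq> k}.
      2 * r k - r i - r j)" for k
  have "(\<Prod>k<n. x - r k) = poly P x"
    by (simp add: P_def poly_prod)
  also have "\<dots> \<in> ideal G"
    using cong[of "\<lambda>i. x ^ i"] assms(2) by (simp add: lin_eval_power)
  finally have x: "(\<Prod>k<n. x - r k) \<in> ideal G" .
  have "(\<Prod>k<n. Q k) \<in> ideal (insert (\<Prod>k<n. x - r k) G)"
    unfolding Q_def using cong assms(3,4)
    by (intro ideal_insert_prod prod_pairs_in_ideal) (auto simp: P_def)
  then obtain l where "(\<Prod>k<n. Q k) - l * (\<Prod>k<n. x - r k) \<in> ideal G"
    unfolding ideal_insert_iff by blast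
  from ideal_add[OF this ideal_mult_left[OF x, of l]] have "(\<Prod>k<n. Q k) \<in> ideal G"
    by simp
  also have "(\<Prod>k<n. Q k) = (\<Prod>(k,i,j)\<in>(SIGMA k:{..<n}. {(i, j). i < n \<and> j < n \<and> i < j \<and> i \<noteq> k \<and> j \<noteq> k}).
      2 * r k - r i - r j)"
    unfolding Q_def
  proof (subst prod.Sigma)
    show "\<forall>k\<in>{..<n}. finite {(i, j). i < n \<and> j < n \<and> i < j \<and> i \<noteq> k \<and> j \<noteq> k}"
      by (auto intro: finite_subset[of _ "{..<n} \<times> {..<n}"])
  qed (auto intro!: prod.cong)
  also have "\<dots> = (\<Prod>(i,j,k)\<in>{(i,j,k). i < n \<and> j < n \<and> k < n \<and> i < j \<and> j \<noteq> k \<and> k \<noteq> i}.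
      2 * r k - r i - r j)"
    by (rule prod.reindex_bij_witness[where i = "\<lambda>(i,j,k). (k,i,j)" and j = "\<lambda>(k,i,j). (i,j,k)"]) auto
  finally show ?thesis .
qed

subsection \<open>Cauchy modules\<close>

primrec cauchy_quotient :: "'a::comm_ring_1 poly \<Rightarrow> (nat \<Rightarrow> 'a) \<Rightarrow> nat \<Rightarrow> 'a poly" where
  "cauchy_quotient F r 0 = F"
| "cauchy_quotient F r (Suc k) = synthetic_div (cauchy_quotient F r k) (r k)"

text \<open>Serves twice: for \<open>k < degree F\<close> the relation on \<open>r k\<close> is
  monic of positive degree and can be eliminated, and for \<open>k = degree F\<close> the quotient
  is 1.\<close>

lemma cauchy_quotient_degree_monic:
  fixes F :: "'a::comm_ring_1 poly"
  assumes "lead_coeff F = 1" "k \<le> degree F"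
  shows "degree (cauchy_quotient F r k) = degree F - k \<and> lead_coeff (cauchy_quotient F r k) = 1"
  using assms(2)
proof (induction k)
  case 0
  then show ?case using assms(1) by simp
next
  case (Suc k)
  define q where "q = cauchy_quotient F r k"
  define q' where "q' = synthetic_div q (r k)"
  have q: "degree q = degree F - k" "lead_coeff q = 1"
    using Suc unfolding q_def by auto
  have deg: "degree q' = degree q - 1"
    by (simp add: q'_def degree_synthetic_div)
  have "degree q \<noteq> 0"
    using q(1) Suc.prems by simp
  then obtain d where d: "degree q = Suc d"
    using not0_implies_Suc by blast
  \<comment> \<open>At the top degree of \<open>q\<close> the summand \<open>smult (r k) q'\<close>
    contributes nothing, so \<open>q'\<close> inherits the leading coefficient.\<close>
  have "coeff (q + smult (r k) q') (Suc d) = coeff (pCons (poly q (r k)) q') (Suc d)"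
    unfolding q'_def by (simp add: synthetic_div_correct)
  then have "coeff q' d = 1"
    using q(2) deg d by (simp add: coeff_eq_0)
  moreover have "d = degree F - Suc k"
    using d q(1) by simp
  ultimately show ?case
    using deg d by (simp add: q'_def q_def)
qed

text \<open>Each synthetic division drops only the constant remainder \<open>q_k(r_k)\<close>, which
  is in the ideal by assumption.\<close>

lemma coeffs_in_cauchy_quotient:
  fixes F :: "'a::comm_ring_1 poly"
  assumes "\<And>j. j < k \<Longrightarrow> poly (cauchy_quotient F r j) (r j) \<in> ideal G"
  shows "coeffs_in (ideal G) (F - (\<Prod>j<k. [:- r j, 1:]) * cauchy_quotient F r k)"
  using assms
proof (induction k)
  case 0
  show ?case by (simp add: coeffs_in_def ideal_zero)
next
  case (Suc k)
  define q where "q = cauchy_quotient F r k"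
  define P where "P = (\<Prod>j<k. [:- r j, 1:])"
  have "F - (\<Prod>j<Suc k. [:- r j, 1:]) * cauchy_quotient F r (Suc k) =
      F - P * ([:- r k, 1:] * synthetic_div q (r k))"
    by (simp only: prod.lessThan_Suc P_def cauchy_quotient.simps q_def mult.assoc)
  also have "[:- r k, 1:] * synthetic_div q (r k) = q - [:poly q (r k):]"
    using synthetic_div_correct'[of "r k" q] by (simp only: eq_diff_eq)
  also have "F - P * (q - [:poly q (r k):]) = (F - P * q) + P * [:poly q (r k):]"
    by (simp add: algebra_simps)
  finally show ?case
    using Suc.IH Suc.prems unfolding q_def P_def
    by (simp only:) (intro coeffs_in_add coeffs_in_mult_left coeffs_in_const; simp)
qed

subsection \<open>Evaluation of multivariate polynomials\<close>

definition mon_eval :: "(nat \<Rightarrow> 'b::comm_ring_1) \<Rightarrow> (nat \<Rightarrow>\<^sub>0 nat) \<Rightarrow> 'b" where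
  "mon_eval \<sigma> m = (\<Prod>i\<in>Poly_Mapping.keys m. \<sigma> i ^ Poly_Mapping.lookup m i)"

lemma mon_eval_superset:
  assumes "finite A" "Poly_Mapping.keys m \<subseteq> A"
  shows "mon_eval \<sigma> m = (\<Prod>i\<in>A. \<sigma> i ^ Poly_Mapping.lookup m i)"
  unfolding mon_eval_def using assms
  by (intro prod.mono_neutral_left) (auto simp: in_keys_iff)

lemma mon_eval_add: "mon_eval \<sigma> (m + m') = mon_eval \<sigma> m * mon_eval \<sigma> m'"
proof -
  let ?A = "Poly_Mapping.keys m \<union> Poly_Mapping.keys m'"
  have "mon_eval \<sigma> (m + m') = (\<Prod>i\<in>?A. \<sigma> i ^ Poly_Mapping.lookup (m + m') i)"
    by (rule mon_eval_superset) (use keys_add[of m m'] in auto)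
  also have "\<dots> = (\<Prod>i\<in>?A. \<sigma> i ^ Poly_Mapping.lookup m i) * (\<Prod>i\<in>?A. \<sigma> i ^ Poly_Mapping.lookup m' i)"
    by (simp add: lookup_add power_add prod.distrib)
  also have "\<dots> = mon_eval \<sigma> m * mon_eval \<sigma> m'"
    by (simp add: mon_eval_superset[of ?A])
  finally show ?thesis .
qed

lemma poly_mapping_eq_sum_single:
  "p = (\<Sum>m\<in>Poly_Mapping.keys p. Poly_Mapping.single m (Poly_Mapping.lookup p m))"
  by (rule poly_mapping_eqI)
    (auto simp: lookup_sum lookup_single when_def in_keys_iff sum.delta)

text \<open>Abstracts over the target ring, so that substitution and the view as a univariate
  polynomial share one proof of the homomorphism laws.\<close>

locale mpoly_evaluation =
  fixes \<phi> :: "rat \<Rightarrow> 'b::comm_ring_1" and \<sigma> :: "nat \<Rightarrow> 'b"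
  assumes hom_zero: "\<phi> 0 = 0" and hom_one: "\<phi> 1 = 1"
    and hom_add: "\<phi> (a + b) = \<phi> a + \<phi> b" and hom_mult: "\<phi> (a * b) = \<phi> a * \<phi> b"
begin

definition ev :: "mpoly \<Rightarrow> 'b" where
  "ev p = (\<Sum>m\<in>Poly_Mapping.keys p. \<phi> (Poly_Mapping.lookup p m) * mon_eval \<sigma> m)"

lemma ev_single: "ev (Poly_Mapping.single m a) = \<phi> a * mon_eval \<sigma> m"
  by (simp add: ev_def hom_zero)

lemma ev_zero [simp]: "ev 0 = 0"
  by (simp add: ev_def)

lemma ev_one [simp]: "ev 1 = 1"
  using ev_single[of 0 1] by (simp add: hom_one mon_eval_def)

lemma ev_mVar [simp]: "ev (mVar i) = \<sigma> i"
  by (simp add: mVar_def ev_single hom_one mon_eval_def)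

lemma ev_mConst [simp]: "ev (mConst c) = \<phi> c"
  by (simp add: mConst_def ev_single mon_eval_def)

lemma ev_add [simp]: "ev (p + q) = ev p + ev q"
  unfolding ev_def
  by (rule setsum_keys_plus_distrib) (simp_all add: hom_zero hom_add distrib_right)

lemma ev_sum [simp]: "ev (\<Sum>i\<in>A. p i) = (\<Sum>i\<in>A. ev (p i))"
  by (induction A rule: infinite_finite_induct) simp_all

lemma ev_mult [simp]: "ev (p * q) = ev p * ev q"
proof -
  have "ev (p * q) = ev ((\<Sum>m\<in>Poly_Mapping.keys p. Poly_Mapping.single m (Poly_Mapping.lookup p m)) *
      (\<Sum>m\<in>Poly_Mapping.keys q. Poly_Mapping.single m (Poly_Mapping.lookup q m)))"
    by (simp flip: poly_mapping_eq_sum_single)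
  also have "\<dots> = ev p * ev q"
    unfolding sum_product ev_sum mult_single ev_single hom_mult mon_eval_add
    unfolding ev_def sum_product by (intro sum.cong refl) (simp add: mult_ac)
  finally show ?thesis .
qed

lemma ev_uminus [simp]: "ev (- p) = - ev p"
  using ev_add[of p "- p"] by (simp add: eq_neg_iff_add_eq_0 add.commute)

lemma ev_diff [simp]: "ev (p - q) = ev p - ev q"
  using ev_add[of p "- q"] by simp

lemma ev_power [simp]: "ev (p ^ k) = ev p ^ k"
  by (induction k) simp_all

lemma ev_pow_odd_even [simp]:
  "ev (pow_odd x y i) = pow_odd (ev x) (ev y) i \<and> ev (pow_even x y i) = pow_even (ev x) (ev y) i"
  by (induction i) simp_all

end

lemma mConst_zero [simp]: "mConst 0 = 0"
  and mConst_one [simp]: "mConst 1 = 1"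
  and mConst_add: "mConst (a + b) = mConst a + mConst b"
  and mConst_mult: "mConst (a * b) = mConst a * mConst b"
  by (simp_all add: mConst_def single_add mult_single)

lemma mConst_numeral [simp]: "mConst (numeral k) = numeral k"
  by (simp add: mConst_def)

interpretation msubst: mpoly_evaluation mConst \<sigma>
  rewrites "mpoly_evaluation.ev mConst \<sigma> = msubst \<sigma>" for \<sigma>
proof -
  show "mpoly_evaluation mConst"
    by unfold_locales (simp_all add: mConst_add mConst_mult)
  then show "mpoly_evaluation.ev mConst \<sigma> = msubst \<sigma>"
    by (simp add: fun_eq_iff mpoly_evaluation.ev_def msubst_def mon_eval_def)
qed

lemma msubst_mVar_id: "msubst mVar p = p"
proof -
  have "mVar i ^ k = Poly_Mapping.single (Poly_Mapping.single i k) 1" for i k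
    by (induction k) (simp_all add: mVar_def mult_single single_add[symmetric])
  moreover have "(\<Prod>i\<in>A. Poly_Mapping.single (f i) 1) = Poly_Mapping.single (\<Sum>i\<in>A. f i) (1::rat)"
    for A :: "nat set" and f :: "nat \<Rightarrow> (nat \<Rightarrow>\<^sub>0 nat)"
    by (induction A rule: infinite_finite_induct) (simp_all add: mult_single)
  ultimately show ?thesis
    by (simp add: msubst_def mConst_def mult_single poly_mapping_eq_sum_single[symmetric])
qed

text \<open>With \<open>\<sigma> = mVar\<close> this is an induction principle: a property stable
  under ring operations passes from the variables to \<open>p\<close>.\<close>

lemma msubst_in_subring:
  assumes "\<And>c. mConst c \<in> S" "\<And>p q. p \<in> S \<Longrightarrow> q \<in> S \<Longrightarrow> p + q \<in> S"
    "\<And>p q. p \<in> S \<Longrightarrow> q \<in> S \<Longrightarrow> p * q \<in> S"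
    and p: "\<And>i. i \<in> mvars p \<Longrightarrow> \<sigma> i \<in> S"
  shows "msubst \<sigma> p \<in> S"
proof -
  have sum: "(\<And>i. i \<in> A \<Longrightarrow> f i \<in> S) \<Longrightarrow> sum f A \<in> S" for f and A :: "(nat \<Rightarrow>\<^sub>0 nat) set"
    using assms(1)[of 0] assms(2) by (induction A rule: infinite_finite_induct) auto
  have prod: "(\<And>i. i \<in> A \<Longrightarrow> f i \<in> S) \<Longrightarrow> prod f A \<in> S" for f and A :: "nat set"
    using assms(1)[of 1] assms(3) by (induction A rule: infinite_finite_induct) auto
  have power: "a \<in> S \<Longrightarrow> a ^ k \<in> S" for a k
    using prod[of "{..<k}" "\<lambda>_. a"] by simp
  show ?thesis
    unfolding msubst_def using p
    by (intro sum assms(1,3) prod power) (auto simp: mvars_def)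
qed

text \<open>Applied with \<open>mVar\<close> and \<open>vieta_sub n\<close>, it replaces the
  coefficients of \<open>f\<close> by symmetric functions of the adjoined roots.\<close>

lemma msubst_cong_ideal:
  assumes "\<And>i. i \<in> mvars p \<Longrightarrow> \<sigma> i - \<tau> i \<in> ideal G"
  shows "msubst \<sigma> p - msubst \<tau> p \<in> ideal G"
proof -
  have "(\<Prod>i\<in>Poly_Mapping.keys m. \<sigma> i ^ Poly_Mapping.lookup m i)
      - (\<Prod>i\<in>Poly_Mapping.keys m. \<tau> i ^ Poly_Mapping.lookup m i) \<in> ideal G"
    if "m \<in> Poly_Mapping.keys p" for m
    using assms that by (intro ideal_prod_cong ideal_power_cong) (auto simp: mvars_def)
  then show ?thesis
    unfolding msubst_def sum_subtractf[symmetric] right_diff_distrib[symmetric]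
    by (intro ideal_sum ideal_mult_left) simp
qed

lemma mvars_mVar: "mvars (mVar i) = {i}"
  by (simp add: mvars_def mVar_def)

lemma mvars_mConst: "mvars (mConst c) = {}"
  by (simp add: mvars_def mConst_def)

lemma mvars_add: "mvars (p + q) \<subseteq> mvars p \<union> mvars q"
  using keys_add[of p q] by (auto simp: mvars_def)

lemma mvars_mult: "mvars (p * q) \<subseteq> mvars p \<union> mvars q"
proof -
  have "Poly_Mapping.keys m \<subseteq> mvars p \<union> mvars q" if m: "m \<in> Poly_Mapping.keys (p * q)" for m
  proof -
    obtain a b where "m = a + b" "a \<in> Poly_Mapping.keys p" "b \<in> Poly_Mapping.keys q"
      using keys_mult[of p q] m by blast
    then show ?thesis
      using keys_add[of a b] by (auto simp: mvars_def)
  qed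
  then show ?thesis by (auto simp: mvars_def)
qed

lemma mvars_msubst:
  assumes "\<And>i. i \<in> mvars p \<Longrightarrow> mvars (\<sigma> i) \<subseteq> A"
  shows "mvars (msubst \<sigma> p) \<subseteq> A"
proof -
  have "msubst \<sigma> p \<in> {p. mvars p \<subseteq> A}"
  proof (rule msubst_in_subring)
    show "p + q \<in> {p. mvars p \<subseteq> A}" if "p \<in> {p. mvars p \<subseteq> A}" "q \<in> {p. mvars p \<subseteq> A}" for p q
      using that mvars_add[of p q] by auto
    show "p * q \<in> {p. mvars p \<subseteq> A}" if "p \<in> {p. mvars p \<subseteq> A}" "q \<in> {p. mvars p \<subseteq> A}" for p q
      using that mvars_mult[of p q] by auto
  qed (use assms in \<open>simp_all add: mvars_mConst\<close>)
  then show ?thesis by simp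
qed

subsection \<open>Elimination of a variable\<close>

text \<open>\<open>as_poly v\<close> regards a polynomial as univariate in \<open>mVar v\<close>.\<close>

interpretation as_poly: mpoly_evaluation "\<lambda>c. [:mConst c:]" "\<lambda>i. if i = v then [:0, 1:] else [:mVar i:]"
  for v
  by unfold_locales (simp_all add: mConst_add mConst_mult one_pCons)

abbreviation as_poly :: "nat \<Rightarrow> mpoly \<Rightarrow> mpoly poly" where
  "as_poly \<equiv> as_poly.ev"

text \<open>Encoding absence of a variable as constancy under \<open>as_poly\<close> makes closure
  under ring operations immediate.\<close>

definition free_of :: "nat \<Rightarrow> mpoly \<Rightarrow> bool" where
  "free_of v p \<longleftrightarrow> as_poly v p = [:p:]"

lemma free_of_mConst: "free_of v (mConst c)"
  by (simp add: free_of_def)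

lemma free_of_mVar: "i \<noteq> v \<Longrightarrow> free_of v (mVar i)"
  by (simp add: free_of_def)

lemma free_of_add: "free_of v p \<Longrightarrow> free_of v q \<Longrightarrow> free_of v (p + q)"
  by (simp add: free_of_def)

lemma free_of_mult: "free_of v p \<Longrightarrow> free_of v q \<Longrightarrow> free_of v (p * q)"
  by (simp add: free_of_def)

lemma free_of_mvars: "v \<notin> mvars p \<Longrightarrow> free_of v p"
  using msubst_in_subring[of "{p. free_of v p}" p mVar]
  by (auto simp: msubst_mVar_id free_of_mConst free_of_add free_of_mult intro!: free_of_mVar)

lemma as_poly_poly:
  assumes "\<And>i. free_of v (coeff c i)"
  shows "as_poly v (poly c (mVar v)) = c"
  using assms
proof (induction c)
  case 0
  show ?case by simp
next
  case (pCons a c)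
  have "free_of v (coeff c i)" for i
    using pCons.prems[of "Suc i"] by simp
  moreover have "free_of v a"
    using pCons.prems[of 0] by simp
  ultimately show ?case
    using pCons.IH by (simp add: free_of_def)
qed

text \<open>Read in \<open>mVar v\<close>, \<open>p\<close> is a multiple of \<open>c\<close> plus a
  polynomial with coefficients in the ideal. Dividing the latter by \<open>c\<close> leaves a
  remainder \<open>r\<close>, and \<open>p - r\<close> is a multiple of \<open>c\<close> of smaller
  degree, hence zero.\<close>

lemma ideal_eliminate_monic:
  assumes G: "\<And>g. g \<in> G \<Longrightarrow> free_of v g"
    and c: "\<And>i. free_of v (coeff c i)" "lead_coeff c = 1" "degree c > 0"
    and p: "free_of v p" "p \<in> ideal (insert (poly c (mVar v)) G)"
  shows "p \<in> ideal G"
proof -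
  obtain k where "p - k * poly c (mVar v) \<in> ideal G"
    using p(2) unfolding ideal_insert_iff by blast
  \<comment> \<open>The generators are constants in \<open>mVar v\<close>, so all coefficients of
    their combinations stay in the ideal.\<close>
  moreover have "coeffs_in (ideal G) (as_poly v h)" if "h \<in> ideal G" for h
    using that
  proof (induction h rule: ideal_induct)
    case zero
    show ?case by (simp add: coeffs_in_def ideal_zero)
  next
    case (add a g h)
    then have "coeffs_in (ideal G) (as_poly v a * [:g:] + as_poly v h)"
      by (intro coeffs_in_add coeffs_in_mult_left coeffs_in_const) (simp_all add: ideal_base)
    then show ?case
      using G[OF add(1)] by (simp add: free_of_def)
  qed
  ultimately have "coeffs_in (ideal G) (as_poly v (p - k * poly c (mVar v)))"
    by blast
  then obtain q r where qr: "as_poly v (p - k * poly c (mVar v)) = c * q + r"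
    "degree r < degree c" "coeffs_in (ideal G) r"
    using coeffs_in_monic_division[OF c(2,3)] by blast
  have "[:p:] - r = c * (q + as_poly v k)"
    using qr(1) p(1) as_poly_poly[OF c(1)] by (simp add: free_of_def algebra_simps)
  moreover have "degree ([:p:] - r) < degree c"
    using qr(2) c(3) by (intro degree_diff_less) simp_all
  ultimately have "[:p:] - r = 0"
    using degree_mult_eq[of c "q + as_poly v k"] c(3) by (cases "q + as_poly v k = 0") auto
  then have "p = coeff r 0" by (metis coeff_pCons_0 eq_iff_diff_eq_0)
  then show ?thesis using qr(3) by (simp add: coeffs_in_def)
qed

subsection \<open>The generic polynomial\<close>

text \<open>The polynomial \<open>f\<close> itself, as an object to which functionals and division
  apply; \<open>fpoly\<close> only gives its values.\<close>

definition generic_poly :: "nat \<Rightarrow> mpoly poly" where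
  "generic_poly n = monom 1 n + (\<Sum>i<n. monom (mVar i) i)"

lemma coeff_generic_poly:
  "coeff (generic_poly n) i = (if i < n then mVar i else if i = n then 1 else 0)"
  by (auto simp: generic_poly_def coeff_sum sum.delta)

lemma degree_generic_poly: "degree (generic_poly n) = n"
  by (rule antisym[OF degree_le le_degree]) (simp_all add: coeff_generic_poly)

lemma lin_eval_generic_poly: "lin_eval c (generic_poly n) = c n + (\<Sum>i<n. mVar i * c i)"
  by (simp add: lin_eval_def degree_generic_poly coeff_generic_poly lessThan_Suc_atMost[symmetric])

lemma poly_generic_poly: "poly (generic_poly n) t = fpoly n t"
  by (simp add: lin_eval_power[symmetric] lin_eval_generic_poly fpoly_def)

section \<open>The difference quotients as linear functionals of \<open>f\<close>\<close>

lemma poly_add_lin_eval: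
  "poly p (x + y) = poly p x + y * lin_eval (pow_odd x y) p + y\<^sup>2 * lin_eval (pow_even x y) p"
  unfolding lin_eval_power[symmetric] lin_eval_mult_fun[symmetric] lin_eval_add_fun[symmetric]
  by (rule arg_cong[where f = "\<lambda>c. lin_eval c p"], rule ext, rule power_add_pow_odd_even)

lemma poly_diff_lin_eval:
  "poly p (x - y) = poly p x - y * lin_eval (pow_odd x y) p + y\<^sup>2 * lin_eval (pow_even x y) p"
proof -
  have "poly p (x - y) =
      lin_eval (\<lambda>i. x ^ i + (- y) * pow_odd x y i + y\<^sup>2 * pow_even x y i) p"
    unfolding lin_eval_power[symmetric]
    by (rule arg_cong[where f = "\<lambda>c. lin_eval c p"], rule ext) (simp add: power_diff_pow_odd_even)
  then show ?thesis
    by (simp only: lin_eval_add_fun lin_eval_mult_fun lin_eval_power) simp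
qed

abbreviation half :: mpoly where "half \<equiv> mConst (1 / 2)"

lemma two_half: "2 * half = 1"
  using mConst_mult[of 2 "1 / 2"] by simp

lemma half_add_half: "half * p + half * p = p"
  using two_half by (metis mult.assoc mult_1 mult_2)

lemma midpoint_eqs:
  "half * (a + b) + half * (b - a) = b" "half * (a + b) - half * (b - a) = a"
  "2 * (half * (b - a)) = b - a" "half * (b - a)\<^sup>2 = 2 * (half * (b - a))\<^sup>2"
proof -
  show "half * (a + b) + half * (b - a) = b" "half * (a + b) - half * (b - a) = a"
    using half_add_half[of a] half_add_half[of b] by (simp_all add: algebra_simps)
  show "2 * (half * (b - a)) = b - a"
    using half_add_half[of "b - a"] by (simp only: mult_2)
  have "2 * (half * (b - a))\<^sup>2 = (2 * half) * (half * (b - a)\<^sup>2)"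
    by (simp only: power2_eq_square mult_ac)
  then show "half * (b - a)\<^sup>2 = 2 * (half * (b - a))\<^sup>2"
    by (simp only: two_half mult_1)
qed

lemma yV_neq_xV: "yV n - xV n \<noteq> 0"
proof
  assume "yV n - xV n = 0"
  then have "mvars (yV n) = mvars (xV n)" by simp
  then show False by (simp add: xV_def yV_def mvars_mVar)
qed

lemma half_neq_0: "half \<noteq> 0"
  using two_half by auto

text \<open>With midpoint \<open>m\<close> and half-difference \<open>d\<close>,
  \<open>f(m + d) - f(m - d)\<close> is twice the odd part in \<open>d\<close>, and
  \<open>2 d = y - x\<close>. Cancelling \<open>y - x\<close> gives uniqueness.\<close>

lemma f1_eq:
  "f1 n = lin_eval (pow_odd (half * (xV n + yV n)) (half * (yV n - xV n))) (generic_poly n)"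
  (is "_ = lin_eval (pow_odd ?m ?d) ?F")
  unfolding f1_def
proof (rule the_equality)
  have "poly ?F (?m + ?d) - poly ?F (?m - ?d) = 2 * ?d * lin_eval (pow_odd ?m ?d) ?F"
    unfolding poly_add_lin_eval poly_diff_lin_eval by (simp add: algebra_simps)
  then show eq: "(yV n - xV n) * lin_eval (pow_odd ?m ?d) ?F = fpoly n (yV n) - fpoly n (xV n)"
    unfolding midpoint_eqs poly_generic_poly by simp
  show "h = lin_eval (pow_odd ?m ?d) ?F"
    if "(yV n - xV n) * h = fpoly n (yV n) - fpoly n (xV n)" for h
    using that eq yV_neq_xV by (metis mult_left_cancel)
qed

text \<open>In the second difference the odd parts and the constant terms cancel, leaving
  \<open>2 d^2\<close> times the functional; the denominator is also \<open>2 d^2\<close>.\<close>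

lemma f3_eq:
  "f3 n = lin_eval (pow_even (half * (xV n + yV n)) (half * (yV n - xV n))) (generic_poly n)"
  (is "_ = lin_eval (pow_even ?m ?d) ?F")
  unfolding f3_def
proof (rule the_equality)
  have "poly ?F (?m + ?d) - 2 * poly ?F ?m + poly ?F (?m - ?d) =
      2 * ?d\<^sup>2 * lin_eval (pow_even ?m ?d) ?F"
    unfolding poly_add_lin_eval poly_diff_lin_eval by (simp add: algebra_simps)
  then show eq: "half * (yV n - xV n)\<^sup>2 * lin_eval (pow_even ?m ?d) ?F =
      fpoly n (yV n) - mConst 2 * fpoly n ?m + fpoly n (xV n)"
    unfolding midpoint_eqs(1,2) midpoint_eqs(4)[symmetric] poly_generic_poly by simp
  have "half * (yV n - xV n)\<^sup>2 \<noteq> 0"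
    using half_neq_0 yV_neq_xV by simp
  then show "h = lin_eval (pow_even ?m ?d) ?F"
    if "half * (yV n - xV n)\<^sup>2 * h = fpoly n (yV n) - mConst 2 * fpoly n ?m + fpoly n (xV n)" for h
    using that eq by (metis mult_left_cancel)
qed

lemma msubst_xy_sub:
  "msubst (xy_sub n) (half * (xV n + yV n)) = xV n"
  "msubst (xy_sub n) (half * (yV n - xV n)) = yV n"
  using half_add_half[of "xV n"] half_add_half[of "yV n"]
  by (simp_all add: xV_def yV_def xy_sub_def algebra_simps)

lemma msubst_lin_eval_generic_poly:
  assumes "\<And>i. i < n \<Longrightarrow> \<sigma> i = mVar i"
  shows "msubst \<sigma> (lin_eval c (generic_poly n)) = lin_eval (\<lambda>i. msubst \<sigma> (c i)) (generic_poly n)"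
  using assms by (simp add: lin_eval_generic_poly)

text \<open>The substitution \<open>xy_sub\<close> fixes the coefficients of \<open>f\<close> and
  sends the midpoint to \<open>x\<close> and the half-difference to \<open>y\<close>.\<close>

lemma g1_eq: "g1 n = lin_eval (pow_odd (xV n) (yV n)) (generic_poly n)"
  and g3_eq: "g3 n = lin_eval (pow_even (xV n) (yV n)) (generic_poly n)"
  unfolding g1_def f1_eq g3_def f3_eq
  by (subst msubst_lin_eval_generic_poly,
      simp add: xy_sub_def, simp only: msubst.ev_pow_odd_even msubst_xy_sub)+

text \<open>\<open>c k\<close> is the Cauchy relation on the root \<open>rV n k\<close>. The last
  quotient is monic of degree 0, hence 1, so \<open>f\<close> splits modulo
  \<open>G\<close>.\<close>

lemma root_prod_in_ideal:
  fixes n :: nat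
  defines "c \<equiv> \<lambda>k. poly (cauchy_quotient (generic_poly n) (rV n) k) (rV n k)"
  assumes "{fpoly n (xV n), g1 n, g3 n} \<union> c ` {..<n} \<subseteq> G"
  shows "coeffs_in (ideal G) (generic_poly n - (\<Prod>k<n. [:- rV n k, 1:]))"
    and "root_prod n \<in> ideal G"
proof -
  have G: "fpoly n (xV n) \<in> ideal G" "g1 n \<in> ideal G" "g3 n \<in> ideal G"
    "\<And>k. k < n \<Longrightarrow> c k \<in> ideal G"
    using assms(2) by (auto intro!: ideal_base)
  have "degree (cauchy_quotient (generic_poly n) (rV n) n) = 0"
    "lead_coeff (cauchy_quotient (generic_poly n) (rV n) n) = 1"
    using cauchy_quotient_degree_monic[of "generic_poly n" n "rV n"]
    by (auto simp: degree_generic_poly coeff_generic_poly)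
  then have "cauchy_quotient (generic_poly n) (rV n) n = 1"
    by (metis degree_eq_zeroE coeff_pCons_0 degree_pCons_0 one_pCons)
  then show split: "coeffs_in (ideal G) (generic_poly n - (\<Prod>k<n. [:- rV n k, 1:]))"
    using coeffs_in_cauchy_quotient[of n "generic_poly n" "rV n" G] G(4) by (simp add: c_def)
  show "root_prod n \<in> ideal G"
    using root_product_in_ideal[OF split, of "xV n" "yV n"] G
    by (simp add: root_prod_def poly_generic_poly g1_eq g3_eq)
qed

section \<open>Variables occurring in the generators and in the Cauchy modules\<close>

definition keep_vars :: "nat \<Rightarrow> nat \<Rightarrow> mpoly" where
  "keep_vars N i = (if i < N then mVar i else 0)"

lemma mvars_msubst_keep_vars: "mvars (msubst (keep_vars N) p) \<subseteq> {..<N}"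
  using mvars_mConst[of 0] by (intro mvars_msubst) (auto simp: keep_vars_def mvars_mVar)

text \<open>So \<open>keep_vars N\<close> induces a retraction onto the polynomials in the first
  \<open>N\<close> variables; being fixed by it serves as a test for containing no root
  variable.\<close>

lemma msubst_keep_vars:
  assumes "mvars p \<subseteq> {..<N}"
  shows "msubst (keep_vars N) p = p"
proof -
  have "msubst (keep_vars N) p = msubst mVar p"
    unfolding msubst_def using assms
    by (intro sum.cong prod.cong arg_cong2[where f = "(*)"] refl) (force simp: mvars_def keep_vars_def)
  then show ?thesis
    by (simp add: msubst_mVar_id)
qed

lemma msubst_keep_vars_generators:
  "msubst (keep_vars (n + 2)) (fpoly n (xV n)) = fpoly n (xV n)"
  "msubst (keep_vars (n + 2)) (g1 n) = g1 n"
  "msubst (keep_vars (n + 2)) (g3 n) = g3 n"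
proof -
  have lin: "msubst (keep_vars (n + 2)) (lin_eval c (generic_poly n)) =
      lin_eval (\<lambda>i. msubst (keep_vars (n + 2)) (c i)) (generic_poly n)" for c
    by (rule msubst_lin_eval_generic_poly) (simp add: keep_vars_def)
  have "msubst (keep_vars (n + 2)) (xV n) = xV n" "msubst (keep_vars (n + 2)) (yV n) = yV n"
    by (simp_all add: keep_vars_def xV_def yV_def)
  then show "msubst (keep_vars (n + 2)) (fpoly n (xV n)) = fpoly n (xV n)"
    "msubst (keep_vars (n + 2)) (g1 n) = g1 n" "msubst (keep_vars (n + 2)) (g3 n) = g3 n"
    unfolding poly_generic_poly[symmetric] lin_eval_power[symmetric] g1_eq g3_eq lin
    by simp_all
qed

lemma free_of_poly:
  assumes "\<And>i. free_of v (coeff p i)" "free_of v a"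
  shows "free_of v (poly p a)"
  using assms(1)
proof (induction p)
  case 0
  show ?case using free_of_mConst[of v 0] by simp
next
  case (pCons b p)
  have "free_of v (coeff p i)" for i
    using pCons.prems[of "Suc i"] by simp
  moreover have "free_of v b"
    using pCons.prems[of 0] by simp
  ultimately show ?case
    using pCons.IH assms(2) by (simp add: free_of_add free_of_mult)
qed

lemma free_of_synthetic_div:
  assumes "\<And>i. free_of v (coeff p i)" "free_of v a"
  shows "free_of v (coeff (synthetic_div p a) i)"
  using assms(1)
proof (induction p arbitrary: i)
  case 0
  show ?case using free_of_mConst[of v 0] by simp
next
  case (pCons b p)
  have "free_of v (coeff p i)" for i
    using pCons.prems[of "Suc i"] by simp
  then show ?case
    using pCons.IH assms(2) by (cases i) (simp_all add: free_of_poly)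
qed

lemma free_of_cauchy_quotient:
  assumes "\<And>i. free_of v (coeff F i)" "\<And>j. j < k \<Longrightarrow> free_of v (r j)"
  shows "free_of v (coeff (cauchy_quotient F r k) i)"
  using assms(2) by (induction k arbitrary: i) (simp_all add: assms(1) free_of_synthetic_div)

lemma D2_in_ideal:
  assumes "is_D2 n P"
  shows "P \<in> ideal {fpoly n (xV n), g1 n, g3 n}"
proof -
  define G where "G = {fpoly n (xV n), g1 n, g3 n}"
  define q where "q = cauchy_quotient (generic_poly n) (rV n)"
  define c where "c k = poly (q k) (rV n k)" for k
  have vars: "mvars P \<subseteq> {..<n}" and P: "msubst (vieta_sub n) P = root_prod n"
    using assms by (simp_all add: is_D2_def)
  have free_generic: "free_of (n + 2 + k) (coeff (generic_poly n) i)" for k i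
    using free_of_mConst[of _ 0] free_of_mConst[of _ 1]
    by (simp add: coeff_generic_poly free_of_mVar)
  \<comment> \<open>The case \<open>j = k\<close> matters: \<open>q k\<close> involves only roots of
    index below \<open>k\<close>, so it is a legitimate coefficient polynomial in the variable
    \<open>rV n k\<close>.\<close>
  have free_q: "free_of (n + 2 + k) (coeff (q j) i)" if "j \<le> k" for i j k
    unfolding q_def using that
    by (intro free_of_cauchy_quotient free_generic) (simp add: rV_def free_of_mVar)
  have free_c: "free_of (n + 2 + k) (c j)" if "j < k" for j k
    unfolding c_def using that
    by (intro free_of_poly free_q) (simp_all add: rV_def free_of_mVar)
  have free_G: "free_of (n + 2 + k) g" if "g \<in> G" for k g
  proof (rule free_of_mvars)
    have "msubst (keep_vars (n + 2)) g = g"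
      using that msubst_keep_vars_generators by (auto simp: G_def)
    then show "n + 2 + k \<notin> mvars g"
      using mvars_msubst_keep_vars[of "n + 2" g] by auto
  qed
  \<comment> \<open>The root of largest index goes first: among the remaining generators only its
    own relation involves it.\<close>
  have eliminate: "P \<in> ideal (G \<union> c ` {..<k}) \<Longrightarrow> P \<in> ideal G" if "k \<le> n" for k
    using that
  proof (induction k)
    case 0
    then show ?case by simp
  next
    case (Suc k)
    have "P \<in> ideal (insert (poly (q k) (mVar (n + 2 + k))) (G \<union> c ` {..<k}))"
      using Suc.prems(1) by (simp add: lessThan_Suc c_def rV_def)
    then have "P \<in> ideal (G \<union> c ` {..<k})"
    proof (rule ideal_eliminate_monic[rotated -1])
      show "free_of (n + 2 + k) g" if "g \<in> G \<union> c ` {..<k}" for g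
        using that free_G free_c by auto
      show "free_of (n + 2 + k) (coeff (q k) i)" for i
        by (rule free_q) simp
      show "lead_coeff (q k) = 1" "degree (q k) > 0"
        using cauchy_quotient_degree_monic[of "generic_poly n" k "rV n"] Suc.prems(2)
        by (auto simp: q_def degree_generic_poly coeff_generic_poly)
      show "free_of (n + 2 + k) P"
        using vars by (intro free_of_mvars) auto
    qed
    then show ?case
      using Suc by simp
  qed
  have sub: "{fpoly n (xV n), g1 n, g3 n} \<union>
      (\<lambda>k. poly (cauchy_quotient (generic_poly n) (rV n) k) (rV n k)) ` {..<n} \<subseteq> G \<union> c ` {..<n}"
    by (auto simp: G_def c_def q_def)
  \<comment> \<open>\<open>msubst mVar\<close> is the identity, and modulo the relations each
    coefficient of \<open>f\<close> equals its Vieta expression, so \<open>P\<close> is congruent to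
    \<open>root_prod n\<close>.\<close>
  have "msubst mVar P - msubst (vieta_sub n) P \<in> ideal (G \<union> c ` {..<n})"
  proof (rule msubst_cong_ideal)
    fix i assume "i \<in> mvars P"
    then have "i < n" using vars by auto
    then show "mVar i - vieta_sub n i \<in> ideal (G \<union> c ` {..<n})"
      using root_prod_in_ideal(1)[OF sub] unfolding coeffs_in_def
      by (auto simp: coeff_generic_poly vieta_sub_def dest!: spec[of _ i])
  qed
  from ideal_add[OF this root_prod_in_ideal(2)[OF sub]] have "P \<in> ideal (G \<union> c ` {..<n})"
    by (simp add: P msubst_mVar_id)
  then show ?thesis
    using eliminate[of n] by (simp add: G_def)
qed

theorem corollary1:
  fixes n :: nat and D2 :: mpoly
  assumes "n \<ge> 3"
    and "is_D2 n D2"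
  shows "(\<exists>h1 h2 h3. mvars h1 \<subseteq> {..<n+2} \<and> mvars h2 \<subseteq> {..<n+2} \<and> mvars h3 \<subseteq> {..<n+2} \<and>
            D2 = h1 * fpoly n (xV n) + h2 * g1 n + h3 * g3 n)
         \<and> mvars D2 \<subseteq> {..<n}"
proof
  show vars: "mvars D2 \<subseteq> {..<n}"
    using assms(2) by (simp add: is_D2_def)
  \<comment> \<open>The cofactors obtained from ideal membership may contain root variables. The
    retraction removes these while fixing \<open>D2\<close> and the three generators.\<close>
  let ?\<tau> = "msubst (keep_vars (n + 2))"
  obtain h1 h2 h3 where "D2 - h1 * fpoly n (xV n) - h2 * g1 n - h3 * g3 n = 0"
    using D2_in_ideal[OF assms(2)]
    by (auto simp: ideal_insert_iff module.span_empty[OF module_times])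
  then have "D2 = h1 * fpoly n (xV n) + h2 * g1 n + h3 * g3 n"
    by (simp add: algebra_simps)
  moreover have "D2 = ?\<tau> D2"
    using vars by (intro msubst_keep_vars[symmetric]) auto
  ultimately have "D2 = ?\<tau> (h1 * fpoly n (xV n) + h2 * g1 n + h3 * g3 n)"
    by metis
  also have "\<dots> = ?\<tau> h1 * fpoly n (xV n) + ?\<tau> h2 * g1 n + ?\<tau> h3 * g3 n"
    by (simp only: msubst.ev_add msubst.ev_mult msubst_keep_vars_generators)
  finally show "\<exists>h1 h2 h3. mvars h1 \<subseteq> {..<n+2} \<and> mvars h2 \<subseteq> {..<n+2} \<and> mvars h3 \<subseteq> {..<n+2} \<and>
            D2 = h1 * fpoly n (xV n) + h2 * g1 n + h3 * g3 n"
    using mvars_msubst_keep_vars by blast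
qed

end
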